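(* Let $p$ be an odd prime, let $m$ be a positive integer, and let $h$ be a primitive of $\mathbb{Z}_p$. Then $A_{p,m}$ is permutation-similar to the circulant matrix whose first row is $[1,\,(h\,(\mathbb{Z}_p))^m,\,(h^2\,(\mathbb{Z}_p))^m,\dots,(h^{p-2}\,(\mathbb{Z}_p))^m]$.
   Context: For an integer $a$ and an integer $p>1$, $a\,(\mathbb{Z}_p)$ denotes the remainder $r\in\{0,1,\dots,p-1\}$ of $a$ on division by $p$, regarded as an integer. For an odd prime $p$ and $1\le i\le p-1$, $i^{-1}$ denotes the multiplicative inverse of $i$ modulo $p$. For an odd prime $p$ and a positive integer $m$, $A_{p,m}$ is the $(p-1)\times(p-1)$ matrix $A_{p,m}=\left[(i^{-1}\cdot j\,(\mathbb{Z}_p))^m\right]_{i,j=1}^{p-1}$, where the outer exponentiation is taken in the integers. A nonzero element $h$ of $\mathbb{Z}_p$ is called primitive (a primitive of $\mathbb{Z}_p$) if $\{h^k\,(\mathbb{Z}_p):1\le k\le p-1\}=\{1,2,\dots,p-1\}$. A square matrix $A$ is permutation-similar to $C$ if there is a permutation matrix $P$ with $PAP^T=C$. The $n\times n$ circulant matrix with first row $[c_0,c_1,\dots,c_{n-1}]$ is the matrix with $(i,j)$ entry $c_{(j-i)\bmod n}$. *)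

theory Defs
  imports
    "HOL-Computational_Algebra.Primes"
    "HOL-Number_Theory.Modular_Inverse"
    "Jordan_Normal_Form.Matrix"
begin

(* Residues modulo p are represented by integers; a (Z_p) is "a mod p". *)

(* Matrix indices in Jordan_Normal_Form start at 0, so the entry at (i, j) is the one
   that the usual indexing by 1, ..., p - 1 places at (i + 1, j + 1). *)
definition A_mat :: "nat \<Rightarrow> nat \<Rightarrow> int mat" where
  "A_mat p m = mat (p - 1) (p - 1)
     (\<lambda>(i, j). ((modular_inverse (int p) (int (i + 1)) * int (j + 1)) mod int p) ^ m)"

(* h may be any integer representative of the residue class. *)
definition primitive_mod :: "nat \<Rightarrow> int \<Rightarrow> bool" where
  "primitive_mod p h \<longleftrightarrow>
     h mod int p \<noteq> 0 \<and> (\<lambda>k. h ^ k mod int p) ` {1..p - 1} = {1..int p - 1}"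

definition permutation_mat :: "nat \<Rightarrow> 'a :: semiring_1 mat \<Rightarrow> bool" where
  "permutation_mat n P \<longleftrightarrow>
     P \<in> carrier_mat n n \<and>
     (\<forall>i<n. \<forall>j<n. P $$ (i, j) \<in> {0, 1}) \<and>
     (\<forall>i<n. \<exists>!j. j < n \<and> P $$ (i, j) = 1) \<and>
     (\<forall>j<n. \<exists>!i. i < n \<and> P $$ (i, j) = 1)"

definition permutation_similar :: "'a :: semiring_1 mat \<Rightarrow> 'a mat \<Rightarrow> bool" where
  "permutation_similar A C \<longleftrightarrow>
     square_mat A \<and> (\<exists>P. permutation_mat (dim_row A) P \<and> P * A * transpose_mat P = C)"

(* The difference j - i must be taken in the integers, since it may be negative. *)
definition circulant_mat :: "'a vec \<Rightarrow> 'a mat" where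
  "circulant_mat c = mat (dim_vec c) (dim_vec c)
     (\<lambda>(i, j). c $ nat ((int j - int i) mod int (dim_vec c)))"

end

theory Submission
  imports Defs "HOL-Number_Theory.Residues"
begin

text \<open>
  Since \<open>h\<close> is primitive, listing the nonzero residues in the order \<open>1, h, h\<^sup>2, \<dots>, h\<^bsup>p-2\<^esup>\<close> is a
  permutation of \<open>1, \<dots>, p - 1\<close>. Conjugating \<open>A\<^sub>p\<^sub>,\<^sub>m\<close> with it puts \<open>(h\<^bsup>-i\<^esup> h\<^sup>j mod p)\<^sup>m\<close> at
  \<open>(i, j)\<close>, and by Fermat's little theorem this depends only on \<open>j - i\<close> modulo \<open>p - 1\<close>.
\<close>

text \<open>The witness has its ones at the positions \<open>(i, \<sigma> i)\<close>. Multiplying by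
  it on the left moves row \<open>\<sigma> i\<close> to row \<open>i\<close>, and its transpose on
  the right does the same to columns.\<close>

lemma permutation_similar_reindex:
  fixes A :: "'a :: semiring_1 mat"
  assumes A: "A \<in> carrier_mat n n" and bij: "bij_betw \<sigma> {..<n} {..<n}"
  shows "permutation_similar A (mat n n (\<lambda>(i, j). A $$ (\<sigma> i, \<sigma> j)))"
proof -
  define P :: "'a mat" where "P = mat n n (\<lambda>(i, j). of_bool (j = \<sigma> i))"
  have \<sigma>_less: "\<sigma> i < n" if "i < n" for i
    using bij_betwE[OF bij] that by auto
  \<comment> \<open>This is the column condition for \<open>P\<close>; the row condition follows
    from \<open>\<sigma>_less\<close> alone.\<close>
  have "\<exists>!i. i < n \<and> j = \<sigma> i" if "j < n" for j
    using bij_betw_imp_inj_on[OF bij] bij_betw_imp_surj_on[OF bij] that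
    by (auto simp: inj_on_def image_iff set_eq_iff)
  then have "permutation_mat n P"
    using \<sigma>_less by (auto simp: permutation_mat_def P_def cong: conj_cong)
  moreover have "P * A * transpose_mat P = mat n n (\<lambda>(i, j). A $$ (\<sigma> i, \<sigma> j))"
    using A \<sigma>_less
    by (intro eq_matI)
       (auto simp: P_def scalar_prod_def of_bool_def if_distrib[of "\<lambda>x. x * _"]
             if_distrib[of "\<lambda>x. _ * x"] cong: if_cong)
  ultimately show ?thesis
    using A by (auto simp: permutation_similar_def)
qed

lemma primitive_mod_coprime:
  assumes "prime p" "primitive_mod p h"
  shows "coprime h (int p)"
proof -
  have "\<not> int p dvd h"
    using assms by (simp add: primitive_mod_def dvd_eq_mod_eq_0)
  then show ?thesis
    using assms(1) prime_imp_coprime[of "int p" h] by (simp add: coprime_commute)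
qed

lemma primitive_mod_power_eq_1:
  assumes "prime p" "primitive_mod p h"
  shows "[h ^ (p - 1) = 1] (mod int p)"
proof -
  \<comment> \<open>\<open>fermat_theorem\<close> speaks of naturals while \<open>h\<close> may be
    negative, so it is applied to the least nonnegative residue of \<open>h\<close>.\<close>
  have "h mod int p \<ge> 0"
    using prime_gt_0_nat[OF assms(1)] by simp
  then have "int p dvd int (nat (h mod int p)) \<longleftrightarrow> h mod int p = 0"
    by (simp add: dvd_eq_mod_eq_0)
  then have "\<not> p dvd nat (h mod int p)"
    using assms(2) by (metis of_nat_dvd_iff primitive_mod_def)
  from fermat_theorem[OF assms(1) this]
  have "[int (nat (h mod int p)) ^ (p - 1) = 1] (mod int p)"
    by (metis cong_int_iff of_nat_1 of_nat_power)
  then show ?thesis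
    using prime_gt_0_nat[OF assms(1)] by (simp add: cong_def power_mod)
qed

text \<open>By Fermat the exponent \<open>p - 1\<close> may be traded for \<open>0\<close>, which
  turns the exponents in the definition into a range matching indices that start at 0.\<close>

lemma primitive_mod_bij_betw:
  assumes p: "prime p" and h: "primitive_mod p h"
  shows "bij_betw (\<lambda>k. h ^ k mod int p) {..<p - 1} {1..int p - 1}"
proof -
  have p1: "p > 1" using p prime_gt_1_nat by blast
  have top: "h ^ (p - 1) mod int p = h ^ 0 mod int p"
    using primitive_mod_power_eq_1[OF p h] by (simp add: cong_def)
  have "{1..p - 1} = insert (p - 1) {1..<p - 1}" "{..<p - 1} = insert 0 {1..<p - 1}"
    using p1 by auto
  then have "(\<lambda>k. h ^ k mod int p) ` {..<p - 1} = (\<lambda>k. h ^ k mod int p) ` {1..p - 1}"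
    using top by simp
  then have img: "(\<lambda>k. h ^ k mod int p) ` {..<p - 1} = {1..int p - 1}"
    using h by (simp add: primitive_mod_def)
  \<comment> \<open>Counting: the image has as many elements as the domain.\<close>
  moreover have "inj_on (\<lambda>k. h ^ k mod int p) {..<p - 1}"
    using p1 by (intro eq_card_imp_inj_on) (simp_all only: img, auto)
  ultimately show ?thesis by (simp add: bij_betw_def)
qed

text \<open>Here \<open>u\<close> acts as the inverse of \<open>h ^ i\<close>, and powers of
  \<open>h\<close> modulo \<open>q\<close> depend only on the exponent modulo
  \<open>n\<close>.\<close>

lemma inverse_power_mult_power_cong:
  fixes h q u :: int
  assumes u: "[u * h ^ i = 1] (mod q)" and h: "[h ^ n = 1] (mod q)" and i: "i < n"
  shows "[u * h ^ j = h ^ nat ((int j - int i) mod int n)] (mod q)"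
proof -
  \<comment> \<open>As \<open>n\<close> is positive, the remainder is nonnegative and
    \<open>nat\<close> preserves it; thus \<open>i + k\<close> agrees with \<open>j\<close> modulo
    \<open>n\<close>.\<close>
  define k where "k = nat ((int j - int i) mod int n)"
  have "int (i + k) mod int n = int j mod int n"
    using i by (simp add: k_def mod_add_right_eq)
  then have "(i + k) mod n = j mod n"
    by (metis of_nat_eq_iff zmod_int)
  have red: "[h ^ a = h ^ (a mod n)] (mod q)" for a
  proof -
    have "[(h ^ n) ^ (a div n) * h ^ (a mod n) = 1 ^ (a div n) * h ^ (a mod n)] (mod q)"
      by (intro cong_mult cong_pow h cong_refl)
    then show ?thesis
      by (simp flip: power_mult power_add)
  qed
  have "[h ^ j = h ^ (i + k)] (mod q)"
    using red[of j] red[of "i + k"] \<open>(i + k) mod n = j mod n\<close> by (metis cong_sym cong_trans)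
  then have "[u * h ^ j = (u * h ^ i) * h ^ k] (mod q)"
    by (metis cong_scalar_left mult.assoc power_add)
  also have "[(u * h ^ i) * h ^ k = 1 * h ^ k] (mod q)"
    using u by (rule cong_scalar_right)
  finally show ?thesis by (simp add: k_def)
qed

theorem theorem2p3:
  fixes p m :: nat and h :: int
  assumes "prime p" and "odd p" and "m > 0" and "primitive_mod p h"
  shows "permutation_similar (A_mat p m)
           (circulant_mat (vec (p - 1) (\<lambda>k. (h ^ k mod int p) ^ m)))"
proof -
  have p1: "p > 1" using assms(1) prime_gt_1_nat by blast
  \<comment> \<open>Index \<open>a\<close> of \<open>A_mat\<close> stands for the residue
    \<open>a + 1\<close>, hence the shift. For \<open>k < p - 1\<close> the residue is at least 1,
    so the subtraction does not truncate.\<close>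
  define \<sigma> where "\<sigma> k = nat (h ^ k mod int p) - 1" for k
  have "bij_betw (\<lambda>x. nat x - 1) {1..int p - 1} {..<p - 1}"
    using p1 by (intro bij_betw_byWitness[where f' = "\<lambda>k. int k + 1"]) auto
  from bij_betw_trans[OF primitive_mod_bij_betw[OF assms(1,4)] this]
  have bij: "bij_betw \<sigma> {..<p - 1} {..<p - 1}"
    by (simp add: \<sigma>_def[abs_def] comp_def)
  have \<sigma>: "\<sigma> k < p - 1" "1 + int (\<sigma> k) = h ^ k mod int p" if "k < p - 1" for k
    using bij_betwE[OF bij] bij_betwE[OF primitive_mod_bij_betw[OF assms(1,4)]] that
    by (auto simp: \<sigma>_def Ball_def)
  have entry: "modular_inverse (int p) (h ^ i mod int p) * (h ^ j mod int p) mod int p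
      = h ^ nat ((int j - int i) mod int (p - 1)) mod int p" if "i < p - 1" for i j
  proof -
    have "coprime (h ^ i mod int p) (int p)"
      using primitive_mod_coprime[OF assms(1,4)] p1 by (simp add: coprime_mod_left_iff)
    then have "[modular_inverse (int p) (h ^ i mod int p) * (h ^ i mod int p) = 1] (mod int p)"
      by (rule cong_modular_inverse2)
    then have "[modular_inverse (int p) (h ^ i mod int p) * h ^ i = 1] (mod int p)"
      by (simp add: cong_def mod_mult_right_eq)
    from inverse_power_mult_power_cong[OF this primitive_mod_power_eq_1[OF assms(1,4)] that]
    show ?thesis by (simp add: cong_def mod_mult_right_eq)
  qed
  have "circulant_mat (vec (p - 1) (\<lambda>k. (h ^ k mod int p) ^ m))
      = mat (p - 1) (p - 1) (\<lambda>(i, j). A_mat p m $$ (\<sigma> i, \<sigma> j))"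
  proof (intro eq_matI)
    fix i j
    assume "i < dim_row (mat (p - 1) (p - 1) (\<lambda>(i, j). A_mat p m $$ (\<sigma> i, \<sigma> j)))"
      and "j < dim_col (mat (p - 1) (p - 1) (\<lambda>(i, j). A_mat p m $$ (\<sigma> i, \<sigma> j)))"
    then have i: "i < p - 1" and j: "j < p - 1" by simp_all
    have "A_mat p m $$ (\<sigma> i, \<sigma> j) = (h ^ nat ((int j - int i) mod int (p - 1)) mod int p) ^ m"
      using \<sigma>(1)[OF i] \<sigma>(1)[OF j] \<sigma>(2)[OF i] \<sigma>(2)[OF j] entry[OF i, of j]
      by (simp add: A_mat_def)
    \<comment> \<open>This bound lets the circulant's first row be evaluated at that index.\<close>
    moreover have "nat ((int j - int i) mod int (p - 1)) < p - 1"
      using i by (simp add: nat_less_iff)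
    ultimately show "circulant_mat (vec (p - 1) (\<lambda>k. (h ^ k mod int p) ^ m)) $$ (i, j)
        = mat (p - 1) (p - 1) (\<lambda>(i, j). A_mat p m $$ (\<sigma> i, \<sigma> j)) $$ (i, j)"
      using i j by (simp add: circulant_mat_def)
  qed (simp_all add: circulant_mat_def)
  moreover have "A_mat p m \<in> carrier_mat (p - 1) (p - 1)"
    by (simp add: A_mat_def)
  ultimately show ?thesis
    using permutation_similar_reindex[OF _ bij] by metis
qed

end
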